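(* Let $S$ and $C$ be compact subsets of $\mathbb{R}$ with $\dim_{\mathsf H} C>0$. If $B$ is a Borel subset of $\mathbb{R}$ and for every $x\in S$ there exists $r(x)\in\mathbb{R}$ such that $r(x)C+x\subset B$, then $\dim_{\mathsf H} B\ge \frac{\dim_{\mathsf H} S}{2}$.
   Context: $\dim_{\mathsf H}$ denotes Hausdorff dimension. For $r,x\in\mathbb{R}$ and $C\subset\mathbb{R}$, $rC+x=\{rc+x : c\in C\}$. *)

theory Defs
  imports "HOL-Analysis.Analysis"
begin

(* |U|^s with the usual conventions |{}|^s = 0 and |U|^0 = 1 for nonempty U;
   powr alone would give 0 powr 0 = 0. *)
definition diam_pow :: "real \<Rightarrow> 'a::metric_space set \<Rightarrow> ennreal" where
  "diam_pow s U =
     (if U = {} then 0 else if s = 0 then 1 else ennreal (diameter U powr s))"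

(* Boundedness is required separately because diameter is real-valued and
   unspecified on unbounded sets. *)
definition delta_cover :: "real \<Rightarrow> 'a::metric_space set \<Rightarrow> (nat \<Rightarrow> 'a set) \<Rightarrow> bool" where
  "delta_cover \<delta> A U \<longleftrightarrow>
     A \<subseteq> (\<Union>i. U i) \<and> (\<forall>i. bounded (U i) \<and> diameter (U i) \<le> \<delta>)"

definition hausdorff_premeasure :: "real \<Rightarrow> real \<Rightarrow> 'a::metric_space set \<Rightarrow> ennreal" where
  "hausdorff_premeasure s \<delta> A = (INF U\<in>Collect (delta_cover \<delta> A). \<Sum>i. diam_pow s (U i))"

definition hausdorff_measure :: "real \<Rightarrow> 'a::metric_space set \<Rightarrow> ennreal" where
  "hausdorff_measure s A = (SUP \<delta>\<in>{0<..}. hausdorff_premeasure s \<delta> A)"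

(* The dimension is infinite if no exponent qualifies; the empty set has dimension 0. *)
definition hausdorff_dim :: "'a::metric_space set \<Rightarrow> ennreal" where
  "hausdorff_dim A = (INF s\<in>{s. 0 \<le> s \<and> hausdorff_measure s A = 0}. ennreal s)"

end

theory Submission
  imports Defs
begin

text \<open>The idea is that a small neighbourhood of \<open>B\<close> cannot contain too many of the sets \<open>r(x) C + x\<close>, because
  two values of \<open>y = r(x) c + x\<close>, for two well separated slopes \<open>c\<close>, already determine \<open>x\<close> up to
  the accuracy of \<open>y\<close>. So if a union of \<open>n\<close> intervals of length \<open>\<rho>\<close> contains \<open>r(x) c + x\<close> for two fixed
  slopes \<open>c\<close> and all \<open>x\<close> in a set \<open>X\<close>, then \<open>X\<close> is covered by \<open>n\<^sup>2\<close> intervals of length about \<open>\<rho>\<close>.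
  The exponent 2 here is the 2 in the theorem.

  Suppose that \<open>dim B < dim S / 2\<close> and choose \<open>dim B < t < s / 2\<close> with \<open>s < dim S\<close>, and
  \<open>0 < \<kappa> < dim C\<close>. Cover \<open>B\<close> by open balls of radii \<open>2\<^sup>-\<^sup>k\<close> whose \<open>t\<close>-th powers have sum at most
  \<open>\<epsilon>\<close>; then at most \<open>\<epsilon> 2\<^sup>k\<^sup>t\<close> of the balls have radius \<open>2\<^sup>-\<^sup>k\<close>. Compactness of \<open>S\<close> and \<open>C\<close>
  allows finitely many of the balls to serve all \<open>x \<in> S\<close> (\<open>uniform_finite_stage\<close>). From now on there is a
  smallest scale, and instead of Frostman measures on \<open>S\<close> and \<open>C\<close> it suffices to have finite sets of
  weighted points that satisfy the Frostman condition with exponents \<open>s\<close> and \<open>\<kappa>\<close> above that scale, as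
  long as the Frostman constants do not depend on the scale (\<open>discrete_frostman\<close>).

  Give level \<open>k\<close> the share \<open>\<beta>\<^sub>k = (1 - q) q\<^sup>k\<close>. For each \<open>x\<close> some level \<open>k\<close> carries at least the fraction
  \<open>\<beta>\<^sub>k\<close> of the slopes \<open>c\<close>, and one \<open>k\<close> occurs in this way for at least the fraction \<open>\<beta>\<^sub>k\<close> of the
  points \<open>x\<close> (\<open>pigeonhole_geometric\<close>, used twice). The Frostman condition on \<open>C\<close> says that most pairs
  of these slopes are at distance more than \<open>\<eta>\<^sub>k\<close>, where \<open>\<eta>\<^sub>k\<close> is of the order \<open>\<beta>\<^sub>k\<close> to the power
  \<open>1 / \<kappa>\<close>; this is where \<open>dim C > 0\<close> is needed. Averaging over pairs of slopes and using the
  Frostman condition on \<open>S\<close>, the remark above gives (\<open>incidence_bound\<close>), up to constants,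
  \<open>\<beta>\<^sub>k\<^sup>3 \<le> (\<epsilon> 2\<^sup>k\<^sup>t)\<^sup>2 (2\<^sup>-\<^sup>k / \<eta>\<^sub>k)\<^sup>s\<close>. Since \<open>2 t < s\<close>, the ratio \<open>q\<close> can be taken so close to 1 that the
  powers of \<open>2\<^sup>k\<close> on the two sides cancel (\<open>exponent_balance\<close>), and a small \<open>\<epsilon>\<close> contradicts the inequality.\<close>

section \<open>Frostman weights at finitely many scales\<close>

text \<open>This is the max-flow half of the Frostman argument on a tree of depth \<open>n\<close>, whose nodes of level \<open>l\<close> are
  the fibres of \<open>cell l\<close> with capacity \<open>h l\<close>. Start with full leaves and go up the tree; whenever
  a node is overfull, scale the weights below it down to its capacity. Scaling never
  violates a capacity. A point whose own ancestors are not scaled keeps the saturated ancestor that it had, and a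
  scaled node is itself saturated, so every point of \<open>A\<close> stays below a saturated node.\<close>

lemma saturated_weights:
  fixes cell :: "nat \<Rightarrow> 'a \<Rightarrow> 'b" and h :: "nat \<Rightarrow> real"
  assumes inj: "inj_on (cell n) F"
    and rep: "\<And>x. x \<in> A \<Longrightarrow> \<exists>y\<in>F. cell n y = cell n x"
    and nested: "\<And>l m x y. l \<le> m \<Longrightarrow> cell m x = cell m y \<Longrightarrow> cell l x = cell l y"
    and hpos: "\<And>l. 0 < h l"
    and "L \<le> n"
  obtains w where "\<And>x. 0 \<le> w x"
    "\<And>l j. L \<le> l \<Longrightarrow> l \<le> n \<Longrightarrow> sum w {x\<in>F. cell l x = j} \<le> h l"
    "\<And>x. x \<in> A \<Longrightarrow> \<exists>l. L \<le> l \<and> l \<le> n \<and> sum w {y\<in>F. cell l y = cell l x} = h l"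
proof -
  have "\<exists>w. (\<forall>x. 0 \<le> w x)
    \<and> (\<forall>l j. L \<le> l \<longrightarrow> l \<le> n \<longrightarrow> sum w {x\<in>F. cell l x = j} \<le> h l)
    \<and> (\<forall>x\<in>A. \<exists>l. L \<le> l \<and> l \<le> n \<and> sum w {y\<in>F. cell l y = cell l x} = h l)"
  using \<open>L \<le> n\<close>
proof (induction rule: inc_induct)
  case base
  define w where "w = (\<lambda>x::'a. h n)"
  have single: "\<exists>y. {x\<in>F. cell n x = j} \<subseteq> {y}" for j
  proof (cases "\<exists>y\<in>F. cell n y = j")
    case True
    then obtain y where "y \<in> F" "cell n y = j" by blast
    then have "{x\<in>F. cell n x = j} \<subseteq> {y}" using inj_onD[OF inj] by blast
    then show ?thesis by blast
  qed blast
  have "sum w {x\<in>F. cell n x = j} \<le> h n" for j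
  proof -
    obtain y where y: "{x\<in>F. cell n x = j} \<subseteq> {y}" using single by blast
    have "sum w {x\<in>F. cell n x = j} \<le> sum w {y}"
      using hpos y by (intro sum_mono2) (auto simp: w_def less_imp_le)
    then show ?thesis by (simp add: w_def)
  qed
  moreover have "sum w {y\<in>F. cell n y = cell n x} = h n" if "x \<in> A" for x
  proof -
    obtain y where "y \<in> F" "cell n y = cell n x" using rep \<open>x \<in> A\<close> by blast
    moreover obtain z where "{y\<in>F. cell n y = cell n x} \<subseteq> {z}" using single by blast
    ultimately have "{y\<in>F. cell n y = cell n x} = {z}" by blast
    then show ?thesis by (simp add: w_def)
  qed
  moreover have "\<forall>x. 0 \<le> w x" using hpos by (simp add: w_def less_imp_le)
  ultimately show ?case
    by (intro exI[of _ w] conjI allI ballI impI exI[of _ n]) (auto dest: le_antisym)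
next
  case (step k)
  then obtain w where w0: "\<And>x. 0 \<le> w x"
    and wle: "\<And>l j. Suc k \<le> l \<Longrightarrow> l \<le> n \<Longrightarrow> sum w {x\<in>F. cell l x = j} \<le> h l"
    and sat: "\<And>x. x \<in> A \<Longrightarrow> \<exists>l. Suc k \<le> l \<and> l \<le> n \<and> sum w {y\<in>F. cell l y = cell l x} = h l"
    by blast
  define m where "m j = sum w {y\<in>F. cell k y = j}" for j
  define w' where "w' x = (if m (cell k x) \<le> h k then w x else w x * (h k / m (cell k x)))" for x
  have w'0: "0 \<le> w' x" for x
    using w0[of x] hpos[of k] by (auto simp: w'_def intro!: mult_nonneg_nonneg divide_nonneg_nonneg)
  have w'le: "w' x \<le> w x" for x
  proof (cases "m (cell k x) \<le> h k")
    case False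
    then have "h k / m (cell k x) \<le> 1"
      using hpos[of k] by (simp add: divide_le_eq_1)
    then have "w x * (h k / m (cell k x)) \<le> w x" using w0[of x] by (rule mult_left_le)
    then show ?thesis using False by (simp add: w'_def)
  qed (simp add: w'_def)
  have mass_k: "sum w' {y\<in>F. cell k y = j} = (if m j \<le> h k then m j else h k)" for j
  proof -
    have "sum w' {y\<in>F. cell k y = j}
      = (\<Sum>y\<in>{y\<in>F. cell k y = j}. if m j \<le> h k then w y else w y * (h k / m j))"
      by (intro sum.cong) (auto simp: w'_def)
    also have "\<dots> = (if m j \<le> h k then m j else m j * (h k / m j))"
    proof (cases "m j \<le> h k")
      case True
      then show ?thesis by (simp add: m_def)
    next
      case False
      then show ?thesis
        using sum_distrib_right[of w "{y\<in>F. cell k y = j}" "h k / m j", folded m_def] by simp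
    qed
    also have "\<dots> = (if m j \<le> h k then m j else h k)"
      using hpos[of k] by auto
    finally show ?thesis .
  qed
  have "sum w' {x\<in>F. cell l x = j} \<le> h l" if l: "k \<le> l" "l \<le> n" for l j
  proof (cases "l = k")
    case True
    then show ?thesis by (simp add: mass_k)
  next
    case False
    have "sum w' {x\<in>F. cell l x = j} \<le> sum w {x\<in>F. cell l x = j}"
      by (intro sum_mono w'le)
    also have "\<dots> \<le> h l" using wle False l by simp
    finally show ?thesis .
  qed
  moreover have "\<exists>l. k \<le> l \<and> l \<le> n \<and> sum w' {y\<in>F. cell l y = cell l x} = h l" if x: "x \<in> A" for x
  proof (cases "m (cell k x) \<le> h k")
    case True
    obtain l where l: "Suc k \<le> l" "l \<le> n" "sum w {y\<in>F. cell l y = cell l x} = h l"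
      using sat[OF x] by blast
    have "sum w' {y\<in>F. cell l y = cell l x} = sum w {y\<in>F. cell l y = cell l x}"
    proof (intro sum.cong refl)
      fix y assume "y \<in> {y\<in>F. cell l y = cell l x}"
      then have "cell k y = cell k x" using nested[of k l y x] l by simp
      then show "w' y = w y" using True by (simp add: w'_def)
    qed
    then show ?thesis using l by (intro exI[of _ l]) simp
  next
    case False
    then show ?thesis using step.hyps by (intro exI[of _ k]) (simp add: mass_k)
  qed
  ultimately show ?case using w'0 by (intro exI[of _ w']) blast
qed
  then obtain w where w: "\<forall>x. 0 \<le> w x"
    "\<forall>l j. L \<le> l \<longrightarrow> l \<le> n \<longrightarrow> sum w {x\<in>F. cell l x = j} \<le> h l"
    "\<forall>x\<in>A. \<exists>l. L \<le> l \<and> l \<le> n \<and> sum w {y\<in>F. cell l y = cell l x} = h l"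
    by (elim exE conjE)
  show thesis
    by (rule that[of w]) (use w in simp_all)
qed

text \<open>This is the matching cut: the topmost saturated cells are pairwise disjoint, so the sum of their capacities, which
  is the weight that they carry, is at most the total weight.
  A lower bound on the cost of covering \<open>A\<close> is therefore a lower bound on the total weight.\<close>

lemma saturated_cells_cover:
  fixes cell :: "nat \<Rightarrow> 'a \<Rightarrow> 'b" and h :: "nat \<Rightarrow> real"
  assumes fin: "finite F"
    and nested: "\<And>l m x y. l \<le> m \<Longrightarrow> cell m x = cell m y \<Longrightarrow> cell l x = cell l y"
    and hpos: "\<And>l. 0 < h l"
    and w0: "\<And>x. 0 \<le> w x"
    and sat: "\<And>x. x \<in> A \<Longrightarrow> \<exists>l. L \<le> l \<and> l \<le> n \<and> sum w {y\<in>F. cell l y = cell l x} = h l"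
  obtains P where "finite P" "\<And>l j. (l, j) \<in> P \<Longrightarrow> L \<le> l"
    "\<And>x. x \<in> A \<Longrightarrow> \<exists>(l, j)\<in>P. cell l x = j" "(\<Sum>(l, j)\<in>P. h l) \<le> sum w F"
proof -
  define Q where "Q x l \<longleftrightarrow> L \<le> l \<and> l \<le> n \<and> sum w {y\<in>F. cell l y = cell l x} = h l" for x l
  define lv where "lv x = (LEAST l. Q x l)" for x
  have lv: "Q x (lv x)" if "x \<in> A" for x
  proof -
    have "\<exists>l. Q x l" using sat[OF that] unfolding Q_def .
    then show ?thesis unfolding lv_def by (rule LeastI_ex)
  qed
  define P where "P = (\<lambda>x. (lv x, cell (lv x) x)) ` A"
  define D where "D p = {y\<in>F. cell (fst p) y = snd p}" for p
  have mass: "sum w (D p) = h (fst p)" if p: "p \<in> P" for p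
  proof -
    obtain x where "x \<in> A" "p = (lv x, cell (lv x) x)" using p by (auto simp: P_def)
    then show ?thesis using lv[of x] by (simp add: D_def Q_def)
  qed
  have "P \<subseteq> (\<lambda>(l, y). (l, cell l y)) ` ({..n} \<times> F)"
  proof
    fix p assume p: "p \<in> P"
    then obtain x where x: "x \<in> A" "p = (lv x, cell (lv x) x)" by (auto simp: P_def)
    have "D p \<noteq> {}" using mass[OF p] hpos[of "fst p"] by force
    then obtain y where "y \<in> F" "cell (lv x) y = cell (lv x) x" using x by (auto simp: D_def)
    moreover have "lv x \<le> n" using lv[OF x(1)] by (simp add: Q_def)
    ultimately show "p \<in> (\<lambda>(l, y). (l, cell l y)) ` ({..n} \<times> F)"
      using x by (intro image_eqI[of _ _ "(lv x, y)"]) auto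
  qed
  then have finP: "finite P" by (rule finite_subset) (use fin in auto)
  have agree: "lv x \<le> lv x'" if "x \<in> A" "x' \<in> A" "cell l x = cell l x'" "lv x' \<le> l" for x x' l
  proof -
    have "cell (lv x') x = cell (lv x') x'" using nested[OF that(4,3)] .
    then have "Q x (lv x')" using lv[OF that(2)] by (simp add: Q_def)
    then show ?thesis unfolding lv_def[of x] by (rule Least_le)
  qed
  have disj: "D p \<inter> D p' = {}" if pp: "p \<in> P" "p' \<in> P" "p \<noteq> p'" for p p'
  proof (rule ccontr)
    assume "D p \<inter> D p' \<noteq> {}"
    then obtain y where y: "y \<in> D p" "y \<in> D p'" by blast
    obtain x x' where x: "x \<in> A" "p = (lv x, cell (lv x) x)"
      and x': "x' \<in> A" "p' = (lv x', cell (lv x') x')" using pp by (auto simp: P_def)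
    have c: "cell (lv x) y = cell (lv x) x" "cell (lv x') y = cell (lv x') x'"
      using y x x' by (auto simp: D_def)
    define l where "l = min (lv x) (lv x')"
    have same: "cell l x = cell l x'"
      using nested[of l "lv x" y x] nested[of l "lv x'" y x'] c by (simp add: l_def)
    have "lv x = lv x'"
    proof (cases "lv x \<le> lv x'")
      case True
      then show ?thesis using agree[OF x'(1) x(1) same[symmetric]] by (simp add: l_def)
    next
      case False
      then show ?thesis using agree[OF x(1) x'(1) same] by (simp add: l_def)
    qed
    then show False using c x x' pp(3) by simp
  qed
  have "(\<Sum>(l, j)\<in>P. h l) = (\<Sum>p\<in>P. sum w (D p))"
    using mass by (intro sum.cong) auto
  also have "\<dots> = sum w (\<Union>p\<in>P. D p)"
    using finP fin disj by (intro sum.UNION_disjoint[symmetric]) (auto simp: D_def)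
  also have "\<dots> \<le> sum w F"
    using fin w0 by (intro sum_mono2) (auto simp: D_def)
  finally have "(\<Sum>(l, j)\<in>P. h l) \<le> sum w F" .
  moreover have "L \<le> l" if "(l, j) \<in> P" for l j using lv that unfolding P_def Q_def by blast
  moreover have "\<exists>(l, j)\<in>P. cell l x = j" if "x \<in> A" for x using that by (auto simp: P_def)
  ultimately show thesis using finP that by simp
qed

lemma hausdorff_premeasure_le_finite_cover:
  fixes A :: "'a::metric_space set"
  assumes fin: "finite P" and cov: "A \<subseteq> (\<Union>p\<in>P. U p)" and "0 \<le> \<delta>"
    and U: "\<And>p. p \<in> P \<Longrightarrow> bounded (U p) \<and> diameter (U p) \<le> \<delta>"
  shows "hausdorff_premeasure s \<delta> A \<le> (\<Sum>p\<in>P. diam_pow s (U p))"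
proof -
  obtain e where e: "bij_betw e {..<card P} P"
    using ex_bij_betw_nat_finite[OF fin] by (auto simp: atLeast0LessThan)
  define V where "V i = (if i < card P then U (e i) else {})" for i
  have eP: "e i \<in> P" if "i < card P" for i using e that by (auto simp: bij_betw_def)
  have "delta_cover \<delta> A V"
  proof -
    have "A \<subseteq> (\<Union>i. V i)"
    proof
      fix x assume "x \<in> A"
      then obtain p where "p \<in> P" "x \<in> U p" using cov by blast
      moreover have "p \<in> e ` {..<card P}"
        using bij_betw_imp_surj_on[OF e] \<open>p \<in> P\<close> by simp
      then obtain i where "i < card P" "e i = p" by auto
      ultimately show "x \<in> (\<Union>i. V i)" by (auto simp: V_def)
    qed
    then show ?thesis using U eP \<open>0 \<le> \<delta>\<close> by (auto simp: delta_cover_def V_def)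
  qed
  then have "hausdorff_premeasure s \<delta> A \<le> (\<Sum>i. diam_pow s (V i))"
    unfolding hausdorff_premeasure_def by (intro INF_lower) simp
  also have "\<dots> = (\<Sum>i<card P. diam_pow s (V i))"
    by (intro suminf_finite) (auto simp: V_def diam_pow_def)
  also have "\<dots> = (\<Sum>i<card P. diam_pow s (U (e i)))"
    by (intro sum.cong) (auto simp: V_def)
  also have "\<dots> = (\<Sum>p\<in>P. diam_pow s (U p))"
    by (rule sum.reindex_bij_betw[OF e])
  finally show ?thesis .
qed

definition dyadic :: "nat \<Rightarrow> real \<Rightarrow> int" where
  "dyadic l x = \<lfloor>x * 2 ^ l\<rfloor>"

lemma dyadic_nested:
  assumes "l \<le> m" "dyadic m x = dyadic m y"
  shows "dyadic l x = dyadic l y"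
proof -
  have "dyadic l z = dyadic m z div 2 ^ (m - l)" for z
  proof -
    have "z * 2 ^ l = (z * 2 ^ m) / real_of_int (2 ^ (m - l))"
    proof -
      have "(2::real) ^ m = 2 ^ l * 2 ^ (m - l)" using \<open>l \<le> m\<close> by (simp flip: power_add)
      then show ?thesis by simp
    qed
    then show ?thesis
      unfolding dyadic_def by (simp only: floor_divide_real_eq_div zero_le_power zero_le_numeral)
  qed
  then show ?thesis using assms(2) by simp
qed

lemma dyadic_eq_imp_close:
  assumes "dyadic l x = dyadic l y"
  shows "\<bar>x - y\<bar> \<le> (1/2) ^ l"
proof -
  have "\<bar>x * 2 ^ l - y * 2 ^ l\<bar> \<le> 1"
    using assms unfolding dyadic_def by linarith
  then have "\<bar>x - y\<bar> * 2 ^ l \<le> 1" by (simp add: abs_mult flip: left_diff_distrib)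
  then show ?thesis by (simp add: field_simps power_divide)
qed

lemma close_imp_dyadic_adjacent:
  assumes "\<bar>x - y\<bar> \<le> (1/2) ^ l"
  shows "dyadic l x \<in> {dyadic l y - 1, dyadic l y, dyadic l y + 1}"
proof -
  have "\<bar>x - y\<bar> * 2 ^ l \<le> 1" using assms by (simp add: field_simps power_divide)
  then have "\<bar>x * 2 ^ l - y * 2 ^ l\<bar> \<le> 1" by (simp add: abs_mult flip: left_diff_distrib)
  then have "\<bar>dyadic l x - dyadic l y\<bar> \<le> 1" unfolding dyadic_def by linarith
  then show ?thesis by auto
qed

lemma dyadic_scale:
  fixes d :: real
  assumes "0 < d" "d \<le> 1"
  obtains l where "(1/2) ^ Suc l < d" "d \<le> (1/2) ^ l"
proof -
  have ex: "\<exists>l. (1/2) ^ Suc l < d"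
  proof -
    obtain m where "(1/2::real) ^ m < d" using real_arch_pow_inv[of d "1/2"] assms by auto
    moreover have "(1/2::real) ^ Suc m \<le> (1/2) ^ m" by simp
    ultimately show ?thesis by (meson le_less_trans)
  qed
  define l where "l = (LEAST l. (1/2) ^ Suc l < d)"
  have l: "(1/2) ^ Suc l < d" unfolding l_def using ex by (rule LeastI_ex)
  have "d \<le> (1/2) ^ l"
  proof (cases l)
    case (Suc m)
    then have "\<not> (1/2) ^ Suc m < d" unfolding l_def by (intro not_less_Least) simp
    then show ?thesis using Suc by simp
  qed (use assms in simp)
  then show ?thesis by (rule that[OF l])
qed

text \<open>A discretised Frostman probability measure. Point masses cannot satisfy the growth condition at
  arbitrarily small radii, so it is imposed from the radius \<open>\<delta>\<close> on only; the content of the notion is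
  that \<open>K\<close> can be kept fixed while \<open>\<delta>\<close> tends to 0.\<close>

definition frostman_weight :: "real set \<Rightarrow> (real \<Rightarrow> real) \<Rightarrow> real \<Rightarrow> real \<Rightarrow> real \<Rightarrow> bool" where
  "frostman_weight F w s K \<delta> \<longleftrightarrow> finite F \<and> (\<forall>x. 0 \<le> w x) \<and> sum w F = 1
     \<and> (\<forall>a d. \<delta> \<le> d \<longrightarrow> sum w {x\<in>F. \<bar>x - a\<bar> \<le> d} \<le> K * d powr s)"

text \<open>Positive measure bounds the cost of all covers by sets of diameter at most some \<open>\<delta>0\<close> from below by \<open>m > 0\<close>.
  Applied to the covers by saturated dyadic cells of levels from \<open>L\<close> to \<open>n\<close>, where \<open>2\<^sup>-\<^sup>L < \<delta>0\<close>, this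
  says that the weights on the dyadic tree have total at least \<open>m\<close> for every depth \<open>n\<close>. Normalising
  them costs a factor \<open>1 / m\<close>, which does not depend on \<open>n\<close>. Radii above \<open>2\<^sup>-\<^sup>L\<close>
  are handled by the trivial bound 1 on the mass.\<close>

lemma discrete_frostman:
  fixes A :: "real set"
  assumes "bounded A" and s: "0 < s" and "hausdorff_measure s A \<noteq> 0"
  obtains K where "1 \<le> K" "\<And>\<delta>. 0 < \<delta> \<Longrightarrow> \<exists>F w. F \<subseteq> A \<and> frostman_weight F w s K \<delta>"
proof -
  have "\<exists>\<delta>0>0. hausdorff_premeasure s \<delta>0 A \<noteq> 0"
  proof (rule ccontr)
    assume "\<not> ?thesis"
    then have "hausdorff_measure s A = (SUP \<delta>\<in>{0::real<..}. 0)"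
      unfolding hausdorff_measure_def by (intro SUP_cong) auto
    then show False using assms(3) by simp
  qed
  then obtain \<delta>0 where \<delta>0: "0 < \<delta>0" "hausdorff_premeasure s \<delta>0 A > 0"
    by (auto simp: zero_less_iff_neq_zero)
  obtain m where m: "0 < m" "ennreal m \<le> hausdorff_premeasure s \<delta>0 A"
  proof (cases "hausdorff_premeasure s \<delta>0 A")
    case (real r)
    then show ?thesis using that[of r] \<delta>0 by (simp add: ennreal_zero_less_mult_iff)
  next
    case top
    then show ?thesis using that[of 1] by simp
  qed
  obtain L where L: "(1/2::real) ^ L < \<delta>0" using real_arch_pow_inv[of \<delta>0 "1/2"] \<delta>0 by auto
  define h where "h l = ((1/2::real) ^ l) powr s" for l
  have hpos: "0 < h l" for l by (simp add: h_def)
  define K where "K = max 1 (max (1 / h L) (3 * 2 powr s / m))"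
  have K: "1 \<le> K" "1 / h L \<le> K" "3 * 2 powr s / m \<le> K" by (auto simp: K_def)
  show ?thesis
  proof (rule that[OF K(1)])
    fix \<delta> :: real assume "0 < \<delta>"
    obtain n0 where n0: "(1/2::real) ^ n0 < \<delta>" using real_arch_pow_inv[of \<delta> "1/2"] \<open>0 < \<delta>\<close> by auto
    define n where "n = max L n0"
    have "(1/2::real) ^ n \<le> (1/2) ^ n0" by (intro power_decreasing) (auto simp: n_def)
    then have n: "L \<le> n" "(1/2) ^ n \<le> \<delta>" using n0 by (simp add: n_def, linarith)
    obtain R where R: "\<And>x. x \<in> A \<Longrightarrow> \<bar>x\<bar> \<le> R" using \<open>bounded A\<close> by (auto simp: bounded_iff)
    have "dyadic n ` A \<subseteq> {\<lfloor>- R * 2 ^ n\<rfloor>..\<lfloor>R * 2 ^ n\<rfloor>}"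
    proof
      fix j assume "j \<in> dyadic n ` A"
      then obtain x where x: "x \<in> A" "j = \<lfloor>x * 2 ^ n\<rfloor>" by (auto simp: dyadic_def)
      have "- R \<le> x" "x \<le> R" using R[OF x(1)] by auto
      then have "- R * 2 ^ n \<le> x * 2 ^ n" "x * 2 ^ n \<le> R * 2 ^ n"
        by (intro mult_right_mono; simp)+
      then show "j \<in> {\<lfloor>- R * 2 ^ n\<rfloor>..\<lfloor>R * 2 ^ n\<rfloor>}"
        unfolding x(2) atLeastAtMost_iff by (intro conjI floor_mono)
    qed
    then have finj: "finite (dyadic n ` A)" by (rule finite_subset) simp
    \<comment> \<open>One point in each cell of the finest level that meets \<open>A\<close>; these are the leaves of the tree.\<close>
    obtain F where F: "F \<subseteq> A" "inj_on (dyadic n) F" "dyadic n ` A = dyadic n ` F"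
      using subset_image_inj[of "dyadic n ` A" "dyadic n" A] by blast
    have finF: "finite F" using F finj finite_imageD by force
    have rep: "\<exists>y\<in>F. dyadic n y = dyadic n x" if "x \<in> A" for x
      using F(3) that by (metis image_iff)
    obtain w where w0: "\<And>x. 0 \<le> w x"
      and wle: "\<And>l j. L \<le> l \<Longrightarrow> l \<le> n \<Longrightarrow> sum w {x\<in>F. dyadic l x = j} \<le> h l"
      and sat: "\<And>x. x \<in> A \<Longrightarrow> \<exists>l. L \<le> l \<and> l \<le> n \<and> sum w {y\<in>F. dyadic l y = dyadic l x} = h l"
      by (rule saturated_weights[where cell = dyadic and n = n and F = F and A = A and h = h and L = L];
          (rule F(2) rep dyadic_nested hpos n(1) that; (assumption | simp)))
    obtain P where P: "finite P" "\<And>l j. (l, j) \<in> P \<Longrightarrow> L \<le> l"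
      "\<And>x. x \<in> A \<Longrightarrow> \<exists>(l, j)\<in>P. dyadic l x = j" "(\<Sum>(l, j)\<in>P. h l) \<le> sum w F"
      by (rule saturated_cells_cover[of F dyadic h w A L n];
          (rule finF dyadic_nested hpos w0 sat that; (assumption | simp)))
    define U where "U p = {x. dyadic (fst p) x = snd p}" for p
    have diam: "bounded (U p) \<and> diameter (U p) \<le> (1/2) ^ fst p" for p
    proof
      have c: "dist x y \<le> (1/2) ^ fst p" if "x \<in> U p" "y \<in> U p" for x y
        using that dyadic_eq_imp_close[of "fst p" x y] by (simp add: U_def dist_real_def)
      then show "bounded (U p)" using bounded_two_points by blast
      show "diameter (U p) \<le> (1/2) ^ fst p"
        using c by (intro diameter_le) (auto simp: dist_norm)
    qed
    have "hausdorff_premeasure s \<delta>0 A \<le> (\<Sum>p\<in>P. diam_pow s (U p))"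
    proof (rule hausdorff_premeasure_le_finite_cover)
      show "finite P" "0 \<le> \<delta>0" using P \<delta>0 by auto
      show "A \<subseteq> (\<Union>p\<in>P. U p)" using P(3) by (fastforce simp: U_def)
      fix p assume p: "p \<in> P"
      have "(1/2::real) ^ fst p \<le> (1/2) ^ L" using P(2)[of "fst p" "snd p"] p by (intro power_decreasing) auto
      then show "bounded (U p) \<and> diameter (U p) \<le> \<delta>0" using diam[of p] L by linarith
    qed
    also have "\<dots> \<le> (\<Sum>p\<in>P. ennreal (h (fst p)))"
    proof (intro sum_mono)
      fix p
      show "diam_pow s (U p) \<le> ennreal (h (fst p))"
        using diam[of p] s by (auto simp: diam_pow_def h_def diameter_ge_0 intro!: ennreal_leI powr_mono2)
    qed
    also have "\<dots> = ennreal (\<Sum>(l, j)\<in>P. h l)"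
      using hpos by (subst sum_ennreal) (auto simp: less_imp_le split_beta)
    also have "\<dots> \<le> ennreal (sum w F)" using P(4) by (rule ennreal_leI)
    finally have "ennreal m \<le> ennreal (sum w F)" using m(2) by (rule order_trans[rotated])
    then have mW: "m \<le> sum w F" using m(1) by (simp add: ennreal_le_iff2 sum_nonneg w0)
    define W where "W = sum w F"
    have W: "0 < W" "m \<le> W" using mW m(1) by (auto simp: W_def)
    define v where "v x = w x / W" for x
    have v0: "0 \<le> v x" for x using w0 W by (simp add: v_def)
    have v1: "sum v F = 1" using W by (simp add: v_def W_def flip: sum_divide_distrib)
    have "sum v {x\<in>F. \<bar>x - a\<bar> \<le> d} \<le> K * d powr s" if d: "\<delta> \<le> d" for a d
    proof -
      have "0 < d" using d \<open>0 < \<delta>\<close> by simp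
      show ?thesis
      proof (cases "(1/2) ^ L \<le> d")
        case True
        have "sum v {x\<in>F. \<bar>x - a\<bar> \<le> d} \<le> sum v F"
          using v0 finF by (intro sum_mono2) auto
        also have "\<dots> \<le> 1 / h L * d powr s"
        proof -
          have "h L \<le> d powr s" unfolding h_def using True s by (intro powr_mono2) auto
          then show ?thesis using hpos[of L] v1 by (simp add: field_simps)
        qed
        also have "\<dots> \<le> K * d powr s" using K by (intro mult_right_mono) auto
        finally show ?thesis .
      next
        case False
        then have "d \<le> 1" using power_le_one[of "1/2::real" L] by simp
        then obtain l where l: "(1/2) ^ Suc l < d" "d \<le> (1/2) ^ l"
          using dyadic_scale \<open>0 < d\<close> by blast
        have "L \<le> l"
        proof (rule ccontr)
          assume "\<not> L \<le> l"
          then have "(1/2::real) ^ L \<le> (1/2) ^ Suc l" by (intro power_decreasing) auto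
          then show False using l(1) False by linarith
        qed
        have "l \<le> n"
        proof (rule ccontr)
          assume "\<not> l \<le> n"
          then have "(1/2::real) ^ l < (1/2) ^ n" by (intro power_strict_decreasing) auto
          then show False using l(2) n(2) d by linarith
        qed
        \<comment> \<open>The scale \<open>l\<close> lies in the range of levels of the tree, and the ball meets three cells of that level at most.\<close>
        define j where "j = dyadic l a"
        define D where "D i = {x\<in>F. dyadic l x = i}" for i
        have "sum v {x\<in>F. \<bar>x - a\<bar> \<le> d} \<le> sum v (D (j - 1) \<union> D j \<union> D (j + 1))"
        proof (rule sum_mono2)
          show "{x\<in>F. \<bar>x - a\<bar> \<le> d} \<subseteq> D (j - 1) \<union> D j \<union> D (j + 1)"
          proof
            fix x assume "x \<in> {x\<in>F. \<bar>x - a\<bar> \<le> d}"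
            then have "x \<in> F" "\<bar>x - a\<bar> \<le> (1/2) ^ l" using l(2) by auto
            then show "x \<in> D (j - 1) \<union> D j \<union> D (j + 1)"
              using close_imp_dyadic_adjacent[of x a l] by (auto simp: D_def j_def)
          qed
        qed (use finF v0 in \<open>auto simp: D_def\<close>)
        also have "\<dots> = sum v (D (j - 1)) + sum v (D j) + sum v (D (j + 1))"
        proof -
          have "finite (D i)" for i using finF by (simp add: D_def)
          moreover have "D (j - 1) \<inter> D j = {}" "(D (j - 1) \<union> D j) \<inter> D (j + 1) = {}"
            by (auto simp: D_def)
          ultimately show ?thesis by (simp add: sum.union_disjoint)
        qed
        also have "\<dots> \<le> 3 * (h l / W)"
        proof -
          have "sum v (D i) \<le> h l / W" for i
            using wle[OF \<open>L \<le> l\<close> \<open>l \<le> n\<close>, of i] W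
            by (simp add: v_def D_def divide_right_mono flip: sum_divide_distrib)
          from this[of "j - 1"] this[of j] this[of "j + 1"] show ?thesis by linarith
        qed
        also have "\<dots> \<le> 3 * ((2 powr s * d powr s) / m)"
        proof -
          have "h l \<le> (2 * d) powr s" unfolding h_def using l s by (intro powr_mono2) auto
          then have "h l \<le> 2 powr s * d powr s" using \<open>0 < d\<close> by (simp add: powr_mult)
          then show ?thesis using W m(1) by (intro mult_left_mono frac_le) auto
        qed
        also have "\<dots> = (3 * 2 powr s / m) * d powr s" by simp
        also have "\<dots> \<le> K * d powr s" using K by (intro mult_right_mono) auto
        finally show ?thesis .
      qed
    qed
    then show "\<exists>F w. F \<subseteq> A \<and> frostman_weight F w s K \<delta>"
      using F(1) finF v0 v1 unfolding frostman_weight_def by blast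
  qed
qed

section \<open>Counting base points that see few intervals\<close>

lemma sum_le_sum_over_cover:
  fixes w :: "'a \<Rightarrow> real"
  assumes "finite P" and E: "\<And>p. p \<in> P \<Longrightarrow> finite (E p)" and w0: "\<And>x. 0 \<le> w x"
    and X: "X \<subseteq> (\<Union>p\<in>P. E p)"
  shows "sum w X \<le> (\<Sum>p\<in>P. sum w (E p))"
proof -
  have fin: "finite (Sigma P E)" using assms(1,2) by (intro finite_SigmaI)
  have "sum w X \<le> sum w (snd ` Sigma P E)"
    using fin w0 X by (intro sum_mono2) force+
  also have "\<dots> \<le> sum (w \<circ> snd) (Sigma P E)"
    using fin w0 by (intro sum_image_le) auto
  also have "\<dots> = (\<Sum>p\<in>P. sum w (E p))"
    using assms(1,2) by (simp add: sum.Sigma split_beta)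
  finally show ?thesis .
qed

text \<open>The shares \<open>(1 - q) q\<^sup>k\<close> add up to less than 1 over any finite range, so the fibres cannot all stay below them.\<close>

lemma pigeonhole_geometric:
  fixes w :: "'a \<Rightarrow> real"
  assumes fin: "finite F" and w0: "\<And>x. 0 \<le> w x" and w1: "sum w F = 1"
    and q: "0 < q" "q < 1"
    and P: "\<And>x. x \<in> F \<Longrightarrow> \<exists>k<M. P x k"
  shows "\<exists>k<M. (1 - q) * q ^ k \<le> sum w {x\<in>F. P x k}"
proof (rule ccontr)
  assume "\<not> ?thesis"
  then have less: "sum w {x\<in>F. P x k} \<le> (1 - q) * q ^ k" if "k < M" for k
    using that by (meson less_imp_le not_le)
  have "sum w F \<le> (\<Sum>k<M. sum w {x\<in>F. P x k})"
    using fin w0 P by (intro sum_le_sum_over_cover) auto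
  also have "\<dots> \<le> (\<Sum>k<M. (1 - q) * q ^ k)" using less by (intro sum_mono) auto
  also have "\<dots> = 1 - q ^ M" by (simp add: one_diff_power_eq flip: sum_distrib_left)
  finally show False using w1 q zero_less_power[of q M] by linarith
qed

text \<open>The lines \<open>c \<mapsto> p c + x\<close> and \<open>c \<mapsto> q c + y\<close> are within \<open>2 \<rho>\<close> of each other at \<open>c\<close> and at \<open>c'\<close>. Their
  difference at 0 is obtained by extrapolation, which loses the factor \<open>2 R / \<eta>\<close>.\<close>

lemma two_slopes_determine_base_point:
  fixes x y c c' u u' :: real
  assumes "\<bar>c\<bar> \<le> R" "\<bar>c'\<bar> \<le> R" "\<eta> < \<bar>c - c'\<bar>" "0 < \<eta>"
    and "\<bar>p * c + x - u\<bar> \<le> \<rho>" "\<bar>p * c' + x - u'\<bar> \<le> \<rho>"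
    and "\<bar>q * c + y - u\<bar> \<le> \<rho>" "\<bar>q * c' + y - u'\<bar> \<le> \<rho>"
  shows "\<bar>x - y\<bar> \<le> 4 * R * \<rho> / \<eta>"
proof -
  define a where "a = (p * c + x) - (q * c + y)"
  define b where "b = (p * c' + x) - (q * c' + y)"
  have ab: "\<bar>a\<bar> \<le> 2 * \<rho>" "\<bar>b\<bar> \<le> 2 * \<rho>" using assms(5-8) by (auto simp: a_def b_def)
  have "(x - y) * (c - c') = c * b - c' * a" by (simp add: a_def b_def algebra_simps)
  then have "\<bar>x - y\<bar> * \<bar>c - c'\<bar> \<le> \<bar>c * b\<bar> + \<bar>c' * a\<bar>"
    unfolding abs_mult[symmetric] by simp
  also have "\<dots> \<le> R * (2 * \<rho>) + R * (2 * \<rho>)"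
    unfolding abs_mult using assms(1,2) ab by (intro add_mono mult_mono) auto
  finally have "\<bar>x - y\<bar> * \<bar>c - c'\<bar> \<le> 4 * R * \<rho>" by simp
  moreover have "\<bar>x - y\<bar> * \<eta> \<le> \<bar>x - y\<bar> * \<bar>c - c'\<bar>" using assms(3) by (intro mult_left_mono) auto
  ultimately show ?thesis using \<open>0 < \<eta>\<close> by (simp add: le_divide_eq)
qed

text \<open>Count the weighted triples \<open>(x, c, c')\<close> such that \<open>x \<in> X\<close>, the slopes \<open>c\<close> and \<open>c'\<close> are
  more than \<open>\<eta>\<close> apart, and the line of \<open>x\<close> is in one of the intervals at both slopes. For each \<open>x\<close> the
  pairs have mass at least \<open>\<beta> \<cdot> \<beta> / 2\<close>, since the slopes within \<open>\<eta>\<close> of a given one have mass at most \<open>\<beta> / 2\<close>. For each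
  pair, the base points are sorted by the two intervals that are hit, and each of these
  \<open>(card I)\<^sup>2\<close> classes is contained in one short interval.\<close>

lemma incidence_bound:
  fixes r :: "real \<Rightarrow> real" and u :: "'i \<Rightarrow> real"
  assumes F: "frostman_weight F w s K \<delta>" and G: "frostman_weight G v \<kappa> K' \<delta>'"
    and GR: "\<And>c. c \<in> G \<Longrightarrow> \<bar>c\<bar> \<le> R"
    and "finite I" and "0 \<le> \<beta>" and "0 < \<eta>" and "0 \<le> K"
    and X: "X \<subseteq> F" "\<beta> \<le> sum w X"
    and hit: "\<And>x. x \<in> X \<Longrightarrow> \<beta> \<le> sum v {c\<in>G. \<exists>i\<in>I. \<bar>r x * c + x - u i\<bar> \<le> \<rho>}"
    and \<eta>: "K' * \<eta> powr \<kappa> \<le> \<beta> / 2" "\<delta>' \<le> \<eta>"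
    and \<delta>: "\<delta> \<le> 4 * R * \<rho> / \<eta>"
  shows "\<beta> ^ 3 / 2 \<le> (real (card I))\<^sup>2 * (K * (4 * R * \<rho> / \<eta>) powr s)"
proof -
  define d where "d = 4 * R * \<rho> / \<eta>"
  define H where "H x c \<longleftrightarrow> (\<exists>i\<in>I. \<bar>r x * c + x - u i\<bar> \<le> \<rho>)" for x c
  have finF: "finite F" and w0: "0 \<le> w x" and finG: "finite G" and v0: "0 \<le> v x" and v1: "sum v G = 1" for x
    using F G by (auto simp: frostman_weight_def)
  have finX: "finite X" using X(1) finF finite_subset by blast
  have Gball: "sum v {c'\<in>G. \<bar>c' - c\<bar> \<le> \<eta>} \<le> \<beta> / 2" for c
  proof -
    have "sum v {c'\<in>G. \<bar>c' - c\<bar> \<le> \<eta>} \<le> K' * \<eta> powr \<kappa>"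
      using G \<eta>(2) by (simp add: frostman_weight_def)
    then show ?thesis using \<eta>(1) by linarith
  qed
  define Z where "Z x c c' = (if H x c \<and> H x c' \<and> \<eta> < \<bar>c - c'\<bar> then 1 else (0::real))" for x c c'
  have pairs: "\<beta> * (\<beta> / 2) \<le> (\<Sum>c\<in>G. \<Sum>c'\<in>G. v c * v c' * Z x c c')" if x: "x \<in> X" for x
  proof -
    have hx: "\<beta> \<le> sum v {c\<in>G. H x c}" using hit[OF x] by (simp add: H_def)
    have far: "\<beta> / 2 \<le> sum v {c'\<in>G. H x c' \<and> \<eta> < \<bar>c - c'\<bar>}" for c
    proof -
      have "sum v {c\<in>G. H x c} \<le> sum v ({c'\<in>G. H x c' \<and> \<eta> < \<bar>c - c'\<bar>} \<union> {c'\<in>G. \<bar>c' - c\<bar> \<le> \<eta>})"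
        using finG v0 by (intro sum_mono2) auto
      also have "\<dots> \<le> sum v {c'\<in>G. H x c' \<and> \<eta> < \<bar>c - c'\<bar>} + sum v {c'\<in>G. \<bar>c' - c\<bar> \<le> \<eta>}"
        using finG v0 by (subst sum.union_inter[symmetric]) (auto intro!: sum_nonneg)
      finally show ?thesis using hx Gball[of c] by linarith
    qed
    have "\<beta> * (\<beta> / 2) \<le> sum v {c\<in>G. H x c} * (\<beta> / 2)"
      using hx \<open>0 \<le> \<beta>\<close> by (intro mult_right_mono) auto
    also have "\<dots> = (\<Sum>c\<in>{c\<in>G. H x c}. v c * (\<beta> / 2))" by (rule sum_distrib_right)
    also have "\<dots> \<le> (\<Sum>c\<in>{c\<in>G. H x c}. v c * sum v {c'\<in>G. H x c' \<and> \<eta> < \<bar>c - c'\<bar>})"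
      using far v0 by (intro sum_mono mult_left_mono) auto
    also have "\<dots> = (\<Sum>c\<in>G. if H x c then v c * sum v {c'\<in>G. H x c' \<and> \<eta> < \<bar>c - c'\<bar>} else 0)"
      using finG by (intro sum.inter_filter) auto
    also have "\<dots> = (\<Sum>c\<in>G. \<Sum>c'\<in>G. v c * v c' * Z x c c')"
    proof (intro sum.cong refl)
      fix c assume "c \<in> G"
      have "sum v {c'\<in>G. H x c' \<and> \<eta> < \<bar>c - c'\<bar>} = (\<Sum>c'\<in>G. if H x c' \<and> \<eta> < \<bar>c - c'\<bar> then v c' else 0)"
        using finG by (intro sum.inter_filter) auto
      then show "(if H x c then v c * sum v {c'\<in>G. H x c' \<and> \<eta> < \<bar>c - c'\<bar>} else 0)
        = (\<Sum>c'\<in>G. v c * v c' * Z x c c')"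
        by (auto simp: Z_def sum_distrib_left intro!: sum.cong)
    qed
    finally show ?thesis .
  qed
  have fibre: "(\<Sum>x\<in>X. w x * Z x c c') \<le> (real (card I))\<^sup>2 * (K * d powr s)" if c: "c \<in> G" "c' \<in> G" for c c'
  proof (cases "\<eta> < \<bar>c - c'\<bar>")
    case True
    define E where "E p = {x\<in>X. \<bar>r x * c + x - u (fst p)\<bar> \<le> \<rho> \<and> \<bar>r x * c' + x - u (snd p)\<bar> \<le> \<rho>}" for p
    have cell: "sum w (E p) \<le> K * d powr s" for p
    proof (cases "E p = {}")
      case True
      then show ?thesis using \<open>0 \<le> K\<close> by simp
    next
      case False
      then obtain a where a: "a \<in> E p" by blast
      have "E p \<subseteq> {x\<in>F. \<bar>x - a\<bar> \<le> d}"
      proof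
        fix x assume x: "x \<in> E p"
        have "\<bar>x - a\<bar> \<le> d" unfolding d_def
          by (rule two_slopes_determine_base_point[of c R c' \<eta> "r x" x "u (fst p)" \<rho> "u (snd p)" "r a"])
             (use GR c True \<open>0 < \<eta>\<close> x a in \<open>auto simp: E_def\<close>)
        then show "x \<in> {x\<in>F. \<bar>x - a\<bar> \<le> d}" using x X(1) by (auto simp: E_def)
      qed
      then have "sum w (E p) \<le> sum w {x\<in>F. \<bar>x - a\<bar> \<le> d}"
        using finF w0 by (intro sum_mono2) auto
      also have "\<dots> \<le> K * d powr s"
        using F \<delta> by (simp add: frostman_weight_def d_def)
      finally show ?thesis .
    qed
    have "(\<Sum>x\<in>X. w x * Z x c c') \<le> sum w {x\<in>X. H x c \<and> H x c'}"
      using finX w0 by (subst sum.inter_filter) (auto simp: Z_def intro!: sum_mono)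
    also have "\<dots> \<le> (\<Sum>p\<in>I \<times> I. sum w (E p))"
    proof (rule sum_le_sum_over_cover)
      show "{x\<in>X. H x c \<and> H x c'} \<subseteq> (\<Union>p\<in>I \<times> I. E p)" by (fastforce simp: H_def E_def)
    qed (use \<open>finite I\<close> finX w0 in \<open>auto simp: E_def\<close>)
    also have "\<dots> \<le> (\<Sum>p\<in>I \<times> I. K * d powr s)" by (intro sum_mono cell)
    also have "\<dots> = (real (card I))\<^sup>2 * (K * d powr s)" by (simp add: card_cartesian_product power2_eq_square)
    finally show ?thesis .
  next
    case False
    then show ?thesis using \<open>0 \<le> K\<close> by (simp add: Z_def)
  qed
  have "\<beta> ^ 3 / 2 = \<beta> * (\<beta> * (\<beta> / 2))" by (simp add: power3_eq_cube)
  also have "\<dots> \<le> sum w X * (\<beta> * (\<beta> / 2))"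
    using X(2) \<open>0 \<le> \<beta>\<close> by (intro mult_right_mono) auto
  also have "\<dots> = (\<Sum>x\<in>X. w x * (\<beta> * (\<beta> / 2)))" by (rule sum_distrib_right)
  also have "\<dots> \<le> (\<Sum>x\<in>X. w x * (\<Sum>c\<in>G. \<Sum>c'\<in>G. v c * v c' * Z x c c'))"
    using pairs w0 by (intro sum_mono mult_left_mono) auto
  also have "\<dots> = (\<Sum>x\<in>X. \<Sum>c\<in>G. \<Sum>c'\<in>G. (v c * v c') * (w x * Z x c c'))"
    by (simp add: sum_distrib_left algebra_simps)
  also have "\<dots> = (\<Sum>c\<in>G. \<Sum>c'\<in>G. (v c * v c') * (\<Sum>x\<in>X. w x * Z x c c'))"
  proof -
    have "(\<Sum>x\<in>X. \<Sum>c\<in>G. \<Sum>c'\<in>G. (v c * v c') * (w x * Z x c c'))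
      = (\<Sum>c\<in>G. \<Sum>x\<in>X. \<Sum>c'\<in>G. (v c * v c') * (w x * Z x c c'))" by (rule sum.swap)
    also have "\<dots> = (\<Sum>c\<in>G. \<Sum>c'\<in>G. \<Sum>x\<in>X. (v c * v c') * (w x * Z x c c'))"
      by (intro sum.cong refl sum.swap)
    finally show ?thesis by (simp only: sum_distrib_left)
  qed
  also have "\<dots> \<le> (\<Sum>c\<in>G. \<Sum>c'\<in>G. (v c * v c') * ((real (card I))\<^sup>2 * (K * d powr s)))"
    using fibre v0 by (intro sum_mono mult_left_mono) auto
  also have "\<dots> = (sum v G * sum v G) * ((real (card I))\<^sup>2 * (K * d powr s))"
    by (subst sum_product) (simp only: sum_distrib_right)
  also have "\<dots> = (real (card I))\<^sup>2 * (K * d powr s)" by (simp add: v1)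
  finally show ?thesis by (simp add: d_def)
qed

section \<open>Finite covers by small balls\<close>

text \<open>For a fixed multiplier \<open>r\<close>, a compact copy of \<open>C\<close> inside an open set stays inside it under a small translation. The
  same stage and the same multiplier therefore work near each \<open>x\<close>, and compactness of \<open>S\<close> makes the stage uniform.\<close>

lemma uniform_finite_stage:
  fixes S C :: "real set" and W :: "nat \<Rightarrow> real set"
  assumes "compact S" "compact C" and opn: "\<And>n. open (W n)" and inc: "incseq W"
    and ex: "\<And>x. x \<in> S \<Longrightarrow> \<exists>r. (\<lambda>c. r * c + x) ` C \<subseteq> (\<Union>n. W n)"
  shows "\<exists>N. \<forall>x\<in>S. \<exists>r. (\<lambda>c. r * c + x) ` C \<subseteq> W N"
proof -
  have "\<exists>N e. 0 < e \<and> (\<forall>y\<in>ball x e. \<exists>r. (\<lambda>c. r * c + y) ` C \<subseteq> W N)" if x: "x \<in> S" for x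
  proof -
    obtain r where r: "(\<lambda>c. r * c + x) ` C \<subseteq> (\<Union>n. W n)" using ex[OF x] by blast
    define Y where "Y = (\<lambda>c. r * c + x) ` C"
    have comp: "compact Y"
      unfolding Y_def using \<open>compact C\<close> by (intro compact_continuous_image continuous_intros)
    obtain D where D: "finite D" "Y \<subseteq> (\<Union>n\<in>D. W n)"
      by (rule compactE_image[OF comp opn r[folded Y_def]])
    obtain N where N: "\<forall>n\<in>D. n \<le> N" using D(1) finite_nat_set_iff_bounded_le by auto
    have "(\<Union>n\<in>D. W n) \<subseteq> W N" using incseqD[OF inc] N by (intro UN_least) simp
    then have sub: "Y \<subseteq> W N" using D(2) by (rule order_trans[rotated])
    obtain e where e: "0 < e" "(\<Union>z\<in>Y. ball z e) \<subseteq> W N"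
      by (rule compact_subset_open_imp_ball_epsilon_subset[OF comp opn sub])
    have "(\<lambda>c. r * c + y) ` C \<subseteq> W N" if y: "y \<in> ball x e" for y
    proof
      fix z assume "z \<in> (\<lambda>c. r * c + y) ` C"
      then obtain c where "c \<in> C" "z = r * c + y" by blast
      then have "z \<in> ball (r * c + x) e" "r * c + x \<in> Y"
        unfolding Y_def using y by (simp add: dist_real_def, intro imageI)
      then show "z \<in> W N" using e(2) by blast
    qed
    then show ?thesis using e(1) by blast
  qed
  then obtain Nf e where Ne: "\<And>x. x \<in> S \<Longrightarrow> 0 < e x"
    "\<And>x y. x \<in> S \<Longrightarrow> y \<in> ball x (e x) \<Longrightarrow> \<exists>r. (\<lambda>c. r * c + y) ` C \<subseteq> W (Nf x)"
    by metis
  have "S \<subseteq> (\<Union>x\<in>S. ball x (e x))" using Ne(1) by auto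
  then obtain D where D: "D \<subseteq> S" "finite D" "S \<subseteq> (\<Union>x\<in>D. ball x (e x))"
    by (rule compactE_image[OF \<open>compact S\<close> open_ball])
  obtain N where N: "\<forall>n\<in>Nf ` D. n \<le> N"
    using D(2) finite_nat_set_iff_bounded_le[of "Nf ` D"] by auto
  have "\<exists>r. (\<lambda>c. r * c + y) ` C \<subseteq> W N" if "y \<in> S" for y
  proof -
    obtain x where x: "x \<in> D" "y \<in> ball x (e x)" using D(3) \<open>y \<in> S\<close> by blast
    then obtain r where "(\<lambda>c. r * c + y) ` C \<subseteq> W (Nf x)" using Ne(2) D(1) by blast
    moreover have "W (Nf x) \<subseteq> W N" using incseqD[OF inc] N x(1) by simp
    ultimately show ?thesis by blast
  qed
  then show ?thesis by blast
qed

text \<open>Powers of \<open>1/2\<close> as radii sort the cover into levels. The exponent is raised from \<open>t0\<close> to \<open>t\<close>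
  so that it is positive: a set of diameter 0 can then be enlarged to a ball at arbitrarily small cost.\<close>

lemma hausdorff_null_ball_cover:
  fixes B :: "real set"
  assumes null: "hausdorff_measure t0 B = 0" and t: "0 \<le> t0" "t0 < t" and "0 < \<epsilon>"
  obtains u k where "B \<subseteq> (\<Union>i. ball (u i) ((1/2) ^ k i))"
    "\<And>N. (\<Sum>i<N::nat. ((1/2) ^ k i) powr t) \<le> \<epsilon>"
proof -
  \<comment> \<open>The radii will be less than \<open>4 * d i\<close>, and the powers of the \<open>d i\<close> will sum to at most \<open>4 * a\<close>.\<close>
  define a where "a = \<epsilon> / (4 * 4 powr t)"
  have a: "0 < a" using \<open>0 < \<epsilon>\<close> by (simp add: a_def)
  have "hausdorff_premeasure t0 (1/2) B \<le> hausdorff_measure t0 B"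
    unfolding hausdorff_measure_def by (rule SUP_upper) simp
  then have "hausdorff_premeasure t0 (1/2) B < ennreal (2 * a)"
    using null a by (simp add: ennreal_zero_less_mult_iff)
  then obtain U where U: "delta_cover (1/2) B U" "(\<Sum>i. diam_pow t0 (U i)) < ennreal (2 * a)"
    unfolding hausdorff_premeasure_def by (auto simp: INF_less_iff)
  \<comment> \<open>The lower bound \<open>e i\<close> keeps the radius positive; the costs \<open>e i powr t\<close> sum to at most \<open>2 * a\<close>.\<close>
  define e where "e i = min (1/2) ((a * (1/2) ^ i) powr (1 / t))" for i
  have e: "0 < e i" "e i \<le> 1/2" "e i powr t \<le> a * (1/2) ^ i" for i
  proof -
    show "0 < e i" "e i \<le> 1/2" using a by (auto simp: e_def)
    have "e i powr t \<le> ((a * (1/2) ^ i) powr (1 / t)) powr t"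
      using t a by (intro powr_mono2) (auto simp: e_def)
    also have "\<dots> = a * (1/2) ^ i" using t a by (simp add: powr_powr)
    finally show "e i powr t \<le> a * (1/2) ^ i" .
  qed
  have dU: "bounded (U i)" "0 \<le> diameter (U i)" "diameter (U i) \<le> 1/2" for i
    using U(1) by (auto simp: delta_cover_def diameter_ge_0)
  define d where "d i = max (diameter (U i)) (e i)" for i
  have d: "0 < d i" "d i \<le> 1/2" "diameter (U i) \<le> d i" for i
    using dU(3)[of i] e[of i] by (auto simp: d_def)
  have "\<exists>l. (1/2) ^ Suc l < 2 * d i \<and> 2 * d i \<le> (1/2) ^ l" for i
    using dyadic_scale[of "2 * d i"] d[of i] by auto
  then obtain k where k: "\<And>i. (1/2) ^ Suc (k i) < 2 * d i" "\<And>i. 2 * d i \<le> (1/2) ^ k i"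
    by metis
  \<comment> \<open>If \<open>U i\<close> is empty, the centre is arbitrary and the ball superfluous but harmless.\<close>
  define u where "u i = (SOME x. x \<in> U i)" for i
  show thesis
  proof (rule that)
    show "B \<subseteq> (\<Union>i. ball (u i) ((1/2) ^ k i))"
    proof
      fix x assume "x \<in> B"
      then obtain i where i: "x \<in> U i" using U(1) by (auto simp: delta_cover_def)
      then have "u i \<in> U i" unfolding u_def by (rule someI)
      then have "dist (u i) x \<le> diameter (U i)" using dU(1) i by (intro diameter_bounded_bound)
      also have "\<dots> < (1/2) ^ k i" using d[of i] k(2)[of i] by linarith
      finally show "x \<in> (\<Union>i. ball (u i) ((1/2) ^ k i))" by auto
    qed
    fix N :: nat
    have diam_sum: "(\<Sum>i<N. diameter (U i) powr t) \<le> 2 * a"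
    proof -
      have "ennreal (diameter (U i) powr t) \<le> diam_pow t0 (U i)" for i
      proof -
        have "diameter (U i) powr t \<le> diameter (U i) powr t0"
          using dU[of i] t by (intro powr_mono') auto
        moreover have "diameter (U i) powr t \<le> 1"
          using dU[of i] t by (intro powr_le1) auto
        ultimately show ?thesis by (auto simp: diam_pow_def intro: ennreal_leI)
      qed
      then have "(\<Sum>i<N. ennreal (diameter (U i) powr t)) \<le> (\<Sum>i<N. diam_pow t0 (U i))"
        by (rule sum_mono)
      also have "\<dots> \<le> (\<Sum>i. diam_pow t0 (U i))" by (rule sum_le_suminf) auto
      also have "\<dots> \<le> ennreal (2 * a)" using U(2) by simp
      finally have "ennreal (\<Sum>i<N. diameter (U i) powr t) \<le> ennreal (2 * a)" by simp
      then show ?thesis using a by (simp add: ennreal_le_iff)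
    qed
    have "(\<Sum>i<N. ((1/2) ^ k i) powr t) \<le> (\<Sum>i<N. 4 powr t * (diameter (U i) powr t + a * (1/2) ^ i))"
    proof (rule sum_mono)
      fix i
      have "((1/2) ^ k i) powr t \<le> (4 * d i) powr t"
        using k(1)[of i] t by (intro powr_mono2) auto
      also have "\<dots> = 4 powr t * d i powr t" using d[of i] by (simp add: powr_mult)
      also have "\<dots> \<le> 4 powr t * (diameter (U i) powr t + a * (1/2) ^ i)"
        using e(3)[of i] a by (intro mult_left_mono) (auto simp: d_def max_def add_increasing add_increasing2)
      finally show "((1/2) ^ k i) powr t \<le> 4 powr t * (diameter (U i) powr t + a * (1/2) ^ i)" .
    qed
    also have "\<dots> = 4 powr t * ((\<Sum>i<N. diameter (U i) powr t) + a * (\<Sum>i<N. (1/2) ^ i))"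
      by (simp add: sum.distrib sum_distrib_left distrib_left)
    also have "\<dots> \<le> 4 powr t * (2 * a + a * 2)"
    proof -
      have "(\<Sum>i<N. (1/2::real) ^ i) \<le> 2" by (simp add: sum_gp_strict)
      then show ?thesis using diam_sum a by (intro mult_left_mono add_mono) auto
    qed
    also have "\<dots> = \<epsilon>" by (simp add: a_def)
    finally show "(\<Sum>i<N. ((1/2) ^ k i) powr t) \<le> \<epsilon>" .
  qed
qed

section \<open>Comparison of the dimensions\<close>

lemma nonzero_measure_above:
  assumes "ennreal a < hausdorff_dim A" "0 \<le> a"
  obtains s where "a < s" "hausdorff_measure s A \<noteq> 0"
proof -
  obtain z where z: "ennreal a < z" "z < hausdorff_dim A" using dense assms(1) by blast
  obtain s where s: "z = ennreal s" "0 \<le> s" using z by (cases z) auto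
  have "hausdorff_measure s A \<noteq> 0"
  proof
    assume "hausdorff_measure s A = 0"
    then have "hausdorff_dim A \<le> ennreal s"
      unfolding hausdorff_dim_def using s by (intro INF_lower) simp
    then show False using z s by simp
  qed
  moreover have "a < s" using z(1) s assms(2) by (simp add: ennreal_less_iff)
  ultimately show thesis by (rule that[rotated])
qed

text \<open>Here \<open>\<rho>\<close> is the radius of the balls of one level, \<open>p * \<rho> powr \<alpha>\<close> is the share of that level, and the
  divisor of \<open>4 * R * \<rho>\<close> is the separation of slopes that the share permits. The condition on \<open>\<alpha>\<close> is
  chosen so that \<open>\<rho>\<close> enters the result only through the square of \<open>\<rho> powr t\<close>, which compensates the
  squared number of balls, and the cube of \<open>\<rho> powr \<alpha>\<close>, which compensates the cube of the share.\<close>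

lemma exponent_balance:
  fixes \<rho> :: real
  assumes pos: "0 < \<rho>" "0 < \<kappa>" "0 < K'" "0 < p" "0 < R"
    and \<alpha>: "\<alpha> * (3 + s / \<kappa>) = s - 2 * t"
  shows "K * (4 * R * \<rho> / (p * \<rho> powr \<alpha> / (2 * K')) powr (1 / \<kappa>)) powr s
    = (K * (4 * R) powr s * (2 * K' / p) powr (s / \<kappa>)) * ((\<rho> powr t)\<^sup>2 * (\<rho> powr \<alpha>) ^ 3)"
proof -
  have base: "(p * \<rho> powr \<alpha> / (2 * K')) powr (s / \<kappa>)
    = inverse ((2 * K' / p) powr (s / \<kappa>)) * \<rho> powr (\<alpha> * s / \<kappa>)"
    using pos by (simp add: powr_mult powr_divide powr_powr divide_simps)
  have "(4 * R * \<rho> / (p * \<rho> powr \<alpha> / (2 * K')) powr (1 / \<kappa>)) powr s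
    = (4 * R) powr s * \<rho> powr s / (p * \<rho> powr \<alpha> / (2 * K')) powr (s / \<kappa>)"
    using pos by (simp add: powr_divide powr_powr powr_mult)
  also have "\<dots> = (4 * R) powr s * (2 * K' / p) powr (s / \<kappa>) * (\<rho> powr s / \<rho> powr (\<alpha> * s / \<kappa>))"
    unfolding base by (simp add: divide_inverse mult_ac)
  also have "\<rho> powr s / \<rho> powr (\<alpha> * s / \<kappa>) = \<rho> powr (2 * t + 3 * \<alpha>)"
  proof -
    have "s - \<alpha> * s / \<kappa> = 2 * t + 3 * \<alpha>" using \<alpha> by (simp add: distrib_left)
    then show ?thesis by (simp flip: powr_diff)
  qed
  also have "\<rho> powr (2 * t + 3 * \<alpha>) = (\<rho> powr t)\<^sup>2 * (\<rho> powr \<alpha>) ^ 3"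
    using pos by (simp add: powr_add powr_power mult.commute)
  finally show ?thesis by (simp add: mult.assoc)
qed

theorem corollary3p5:
  fixes S C B :: "real set"
  assumes "compact S" and "compact C"
    and "hausdorff_dim C > 0"
    and "B \<in> sets borel"
    and "\<forall>x\<in>S. \<exists>r::real. (\<lambda>c. r * c + x) ` C \<subseteq> B"
  shows "hausdorff_dim B \<ge> hausdorff_dim S / 2"
proof (rule ccontr)
  assume "\<not> ?thesis"
  then have "hausdorff_dim B < hausdorff_dim S / 2" by simp
  then obtain t0 where t0: "0 \<le> t0" "hausdorff_measure t0 B = 0" "ennreal t0 < hausdorff_dim S / 2"
    unfolding hausdorff_dim_def[of B] by (auto simp: INF_less_iff)
  have "ennreal (2 * t0) < hausdorff_dim S"
  proof (rule ccontr)
    assume "\<not> ?thesis"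
    then have "hausdorff_dim S / 2 \<le> ennreal (2 * t0) / 2"
      by (intro divide_right_mono_ennreal) simp
    also have "\<dots> = ennreal t0" using divide_ennreal[of "2 * t0" 2] t0(1) by simp
    finally show False using t0(3) by simp
  qed
  then obtain s where s: "2 * t0 < s" "hausdorff_measure s S \<noteq> 0"
    using nonzero_measure_above[of "2 * t0" S] t0(1) by auto
  obtain \<kappa> where \<kappa>: "0 < \<kappa>" "hausdorff_measure \<kappa> C \<noteq> 0"
    using nonzero_measure_above[of 0 C] assms(3) by auto
  have "0 < s" using s t0 by simp
  obtain K where K: "1 \<le> K"
    "\<And>\<delta>. 0 < \<delta> \<Longrightarrow> \<exists>F w. F \<subseteq> S \<and> frostman_weight F w s K \<delta>"
    using discrete_frostman[OF compact_imp_bounded[OF \<open>compact S\<close>] \<open>0 < s\<close> s(2)] by metis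
  obtain K' where K': "1 \<le> K'"
    "\<And>\<delta>. 0 < \<delta> \<Longrightarrow> \<exists>G v. G \<subseteq> C \<and> frostman_weight G v \<kappa> K' \<delta>"
    using discrete_frostman[OF compact_imp_bounded[OF \<open>compact C\<close>] \<kappa>] by metis
  obtain R0 where R0: "\<And>c. c \<in> C \<Longrightarrow> \<bar>c\<bar> \<le> R0"
    using compact_imp_bounded[OF \<open>compact C\<close>] by (auto simp: bounded_iff)
  define R where "R = max 1 R0"
  have R: "1 \<le> R" "\<And>c. c \<in> C \<Longrightarrow> \<bar>c\<bar> \<le> R" using R0 by (auto simp: R_def max.coboundedI2)
  define t where "t = (t0 + s / 2) / 2"
  have t: "t0 < t" "2 * t < s" using s by (auto simp: t_def)
  \<comment> \<open>The loss from \<open>q < 1\<close> is \<open>\<rho>\<close> to the power \<open>3 \<alpha>\<close> from the three pigeonhole factors and \<open>\<alpha> s / \<kappa>\<close>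
    from the separation of slopes; this \<open>\<alpha>\<close> makes it use up the gain \<open>s - 2 t\<close>.\<close>
  define \<alpha> where "\<alpha> = (s - 2 * t) / (3 + s / \<kappa>)"
  have "0 < 3 + s / \<kappa>" using \<open>0 < s\<close> \<kappa> by (simp add: add_pos_pos)
  then have \<alpha>: "0 < \<alpha>" "\<alpha> * (3 + s / \<kappa>) = s - 2 * t" using t(2) by (auto simp: \<alpha>_def)
  define q where "q = (1/2) powr \<alpha>"
  have q: "0 < q" "q < 1" using \<alpha>(1) powr_less_mono2[of \<alpha> "1/2" 1] by (auto simp: q_def)
  define p where "p = 1 - q"
  have p: "0 < p" "p < 1" using q by (auto simp: p_def)
  have qpow: "q ^ m = ((1/2) ^ m) powr \<alpha>" for m
    by (simp add: q_def powr_power powr_powr mult.commute flip: powr_realpow)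
  define \<beta> where "\<beta> m = p * q ^ m" for m :: nat
  \<comment> \<open>The Frostman bound of a ball of radius \<open>\<eta> m\<close> in \<open>C\<close> is \<open>\<beta> m / 2\<close>.\<close>
  define \<eta> where "\<eta> m = (\<beta> m / (2 * K')) powr (1 / \<kappa>)" for m
  define A where "A = K * (4 * R) powr s * (2 * K' / p) powr (s / \<kappa>)"
  have A: "0 < A" using K(1) K'(1) R(1) p by (simp add: A_def)
  define \<epsilon> where "\<epsilon> = sqrt (p ^ 3 / (4 * A))"
  have \<epsilon>: "0 < \<epsilon>" "A * \<epsilon>\<^sup>2 = p ^ 3 / 4" using p A by (auto simp: \<epsilon>_def)
  obtain u k where cover: "B \<subseteq> (\<Union>i. ball (u i) ((1/2) ^ k i))"
    and small: "\<And>N. (\<Sum>i<N::nat. ((1/2) ^ k i) powr t) \<le> \<epsilon>"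
    using hausdorff_null_ball_cover[OF t0(2) t0(1) t(1) \<epsilon>(1)] by metis
  define W where "W N = (\<Union>i<N. ball (u i) ((1/2) ^ k i))" for N :: nat
  have "\<exists>N. \<forall>x\<in>S. \<exists>r. (\<lambda>c. r * c + x) ` C \<subseteq> W N"
  proof (rule uniform_finite_stage[OF \<open>compact S\<close> \<open>compact C\<close>])
    show "open (W n)" for n by (auto simp: W_def)
    show "incseq W" unfolding incseq_def W_def by (intro allI impI UN_mono) auto
    fix x assume "x \<in> S"
    then obtain r where r: "(\<lambda>c. r * c + x) ` C \<subseteq> B" using assms(5) by blast
    have "(\<Union>i. ball (u i) ((1/2) ^ k i)) \<subseteq> (\<Union>n. W n)"
      unfolding W_def by blast
    then show "\<exists>r. (\<lambda>c. r * c + x) ` C \<subseteq> (\<Union>n. W n)" using r cover by (meson order_trans)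
  qed
  then obtain N r where r: "\<And>x. x \<in> S \<Longrightarrow> (\<lambda>c. r x * c + x) ` C \<subseteq> W N" by metis
  define M where "M = Suc (\<Sum>i<N. k i)"
  have M: "k i < M" if "i < N" for i
    using that member_le_sum[of i "{..<N}" k] by (simp add: M_def)
  have \<beta>: "0 < \<beta> m" "\<beta> m \<le> 1" for m
    using p q power_le_one[of q m] by (auto simp: \<beta>_def intro: mult_le_one)
  have \<eta>: "0 < \<eta> m" "\<eta> m \<le> 1" for m
    using \<beta>[of m] K'(1) \<kappa>(1) by (auto simp: \<eta>_def intro!: powr_le1)
  have \<eta>anti: "\<eta> M \<le> \<eta> m" if "m < M" for m
  proof -
    have "q ^ M \<le> q ^ m" using q that by (intro power_decreasing) auto
    then have "\<beta> M \<le> \<beta> m" using p by (simp add: \<beta>_def)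
    then show ?thesis
      unfolding \<eta>_def using \<beta>[of M] K'(1) \<kappa>(1) by (intro powr_mono2 divide_right_mono) auto
  qed
  \<comment> \<open>All balls have radius at least \<open>(1/2) ^ M\<close> and all separations are at least \<open>\<eta> M\<close>, so weights at these scales suffice.\<close>
  obtain F w where F: "F \<subseteq> S" "frostman_weight F w s K ((1/2) ^ M)" using K(2)[of "(1/2) ^ M"] by auto
  obtain G v where G: "G \<subseteq> C" "frostman_weight G v \<kappa> K' (\<eta> M)" using K'(2)[OF \<eta>(1)] by blast
  define I where "I m = {i. i < N \<and> k i = m}" for m
  define hit where "hit x m = {c\<in>G. \<exists>i\<in>I m. \<bar>r x * c + x - u i\<bar> \<le> (1/2) ^ m}" for x m
  have "\<exists>m<M. (1 - q) * q ^ m \<le> sum v (hit x m)" if x: "x \<in> F" for x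
    unfolding hit_def
  proof (rule pigeonhole_geometric)
    show "finite G" "sum v G = 1" "0 \<le> v c" for c using G(2) by (auto simp: frostman_weight_def)
    fix c assume "c \<in> G"
    then have "r x * c + x \<in> W N" using r[of x] x F(1) G(1) by blast
    then obtain i where "i < N" "\<bar>r x * c + x - u i\<bar> < (1/2) ^ k i"
      by (auto simp: W_def dist_real_def abs_minus_commute)
    then show "\<exists>m<M. \<exists>i\<in>I m. \<bar>r x * c + x - u i\<bar> \<le> (1/2) ^ m"
      using M by (intro exI[of _ "k i"]) (auto simp: I_def intro!: exI[of _ i])
  qed (use q in auto)
  then have "\<exists>m<M. \<beta> m \<le> sum v (hit x m)" if "x \<in> F" for x
    using that unfolding \<beta>_def p_def by blast
  then have "\<exists>m<M. (1 - q) * q ^ m \<le> sum w {x\<in>F. \<beta> m \<le> sum v (hit x m)}"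
    using F(2) q by (intro pigeonhole_geometric) (auto simp: frostman_weight_def)
  then obtain m where m: "m < M" "\<beta> m \<le> sum w {x\<in>F. \<beta> m \<le> sum v (hit x m)}"
    unfolding \<beta>_def p_def by blast
  define \<rho> :: real where "\<rho> = (1/2) ^ m"
  have \<rho>: "0 < \<rho>" by (simp add: \<rho>_def)
  define n where "n = real (card (I m))"
  have "\<beta> m ^ 3 / 2 \<le> n\<^sup>2 * (K * (4 * R * \<rho> / \<eta> m) powr s)"
    unfolding n_def
  proof (rule incidence_bound[OF F(2) G(2)])
    show "K' * \<eta> m powr \<kappa> \<le> \<beta> m / 2"
      using \<beta>(1)[of m] K'(1) \<kappa>(1) by (simp add: \<eta>_def powr_powr)
    show "(1/2) ^ M \<le> 4 * R * \<rho> / \<eta> m"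
    proof -
      have "(1/2) ^ M \<le> \<rho>" unfolding \<rho>_def using m(1) by (intro power_decreasing) auto
      moreover have "\<rho> * \<eta> m \<le> 4 * R * \<rho>"
        using \<eta>[of m] \<rho> R(1) mult_mono[of "\<eta> m" "4 * R" \<rho> \<rho>] by (simp add: mult.commute)
      then have "\<rho> \<le> 4 * R * \<rho> / \<eta> m" using \<eta>(1)[of m] by (simp add: le_divide_eq)
      ultimately show ?thesis by linarith
    qed
    show "\<beta> m \<le> sum w {x\<in>F. \<beta> m \<le> sum v (hit x m)}" by (rule m(2))
    show "\<beta> m \<le> sum v {c\<in>G. \<exists>i\<in>I m. \<bar>r x * c + x - u i\<bar> \<le> \<rho>}"
      if "x \<in> {x\<in>F. \<beta> m \<le> sum v (hit x m)}" for x
      using that by (simp add: hit_def \<rho>_def)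
  qed (use G(1) R(2) \<beta>(1)[of m] \<eta>(1)[of m] K(1) \<eta>anti[OF m(1)] in \<open>auto simp: I_def less_imp_le\<close>)
  also have "K * (4 * R * \<rho> / \<eta> m) powr s = A * ((\<rho> powr t)\<^sup>2 * (\<rho> powr \<alpha>) ^ 3)"
    unfolding A_def \<eta>_def \<beta>_def qpow \<rho>_def[symmetric]
    using \<rho> \<kappa>(1) K'(1) p(1) R(1) \<alpha>(2) by (intro exponent_balance) auto
  also have "n\<^sup>2 * (A * ((\<rho> powr t)\<^sup>2 * (\<rho> powr \<alpha>) ^ 3)) = A * (n * \<rho> powr t)\<^sup>2 * (\<rho> powr \<alpha>) ^ 3"
    by (simp add: power_mult_distrib mult_ac)
  finally have "p ^ 3 / 2 * (\<rho> powr \<alpha>) ^ 3 \<le> A * (n * \<rho> powr t)\<^sup>2 * (\<rho> powr \<alpha>) ^ 3"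
    by (simp add: \<beta>_def qpow \<rho>_def power_mult_distrib)
  then have "p ^ 3 / 2 \<le> A * (n * \<rho> powr t)\<^sup>2" using \<rho> by (simp add: mult_le_cancel_right)
  also have "\<dots> \<le> A * \<epsilon>\<^sup>2"
  proof -
    have "n * \<rho> powr t = (\<Sum>i\<in>I m. ((1/2) ^ k i) powr t)"
      by (simp add: n_def \<rho>_def I_def)
    also have "\<dots> \<le> (\<Sum>i<N. ((1/2) ^ k i) powr t)" by (intro sum_mono2) (auto simp: I_def)
    also have "\<dots> \<le> \<epsilon>" by (rule small)
    finally have "(n * \<rho> powr t)\<^sup>2 \<le> \<epsilon>\<^sup>2" by (intro power_mono) (auto simp: n_def)
    then show ?thesis using A by simp
  qed
  also have "\<dots> = p ^ 3 / 4" by (rule \<epsilon>(2))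
  finally show False using p(1) zero_less_power[of p 3] by linarith
qed

end
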